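(* Let $\mathcal{H}\subseteq\mathcal{B}$, $L:\mathcal{B}\to\mathbb{R}$ and $\nabla L:\mathcal{B}\to\mathcal{B}$ be as in the context. Let $\epsilon\in(0,1)$, $\eta>0$, $T\ge 1$, $f_0\in\mathcal{B}$, and let $(f_t)_{t=0}^{T}$, $(g_t)_{t=0}^{T-1}$ in $\mathcal{B}$ and real numbers $(U_t)_{t=0}^{T-1}$ be produced by $T$ iterations of adaptive functional gradient descent with tolerance $\epsilon$ and learning rate $\eta$; that is, for every $t=0,\dots,T-1$, $$\lVert g_t-\nabla L(f_t)\rVert_{\mathcal{B}}\le U_t,\qquad (1+\epsilon)\,U_t<\epsilon\,\lVert g_t\rVert_{\mathcal{B}},\qquad f_{t+1}=f_t-\eta g_t .$$ Then: (i) (Relative error bound) For all $t=0,\dots,T-1$, $\ \mathrm{RelErr}(g_t,\nabla L(f_t))\le \dfrac{\epsilon}{1+\epsilon}<\dfrac12$. (ii) (Convergence to a stationary point) Put $\bar\epsilon:=\epsilon/(1+\epsilon)$. Suppose in addition that there are constants $K,\alpha,\beta>0$ and $L^\star\in\mathbb{R}$ such that conditions (Smooth), (Descent) and (Compat) of the context hold, $L(f)\ge L^\star$ for all $f\in\mathcal{B}$, $\bar\epsilon<\min\{1/2,\ \alpha/(\alpha+\beta)\}$, and $\eta<\dfrac{2(\alpha-(\alpha+\beta)\bar\epsilon)}{K(2\bar\epsilon+1)}$. Then $$\min_{t=0,\dots,T-1}\lVert\nabla L(f_t)\rVert_{\mathcal{B}}^2\le\frac{L(f_0)-L^\star}{T\,\eta\,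 r},\qquad\text{where } r:=\alpha-\frac{K\eta}{2}-\Bigl(\beta+\frac32K\eta\Bigr)\frac{\bar\epsilon}{1-\bar\epsilon}>0 .$$ (iii) (Convergence to a global minimizer) Suppose in addition to all the hypotheses of (ii) that $L^\star=\inf_{f'\in\mathcal{H}}L(f')$ and that there is $\mu>0$ such that condition (PL) of the context holds. Then, with the same $r$, $$L(f_T)-L^\star\le\bigl[1-2\eta\beta^{-2}\mu r\bigr]^T\bigl(L(f_0)-L^\star\bigr).$$
   Context: $\mathcal{H}$ is a real Hilbert space contained (as a linear subspace) in a real Banach space $\mathcal{B}$, with dual $\mathcal{B}^*$ and dual norm $\lVert u\rVert_{\mathcal{B}^*}=\sup_{\lVert b\rVert_{\mathcal{B}}\le1}|u(b)|$. One is given a Fréchet differentiable loss on $\mathcal{H}$, with Riesz gradient operator $\mathcal{H}\to\mathcal{H}$ characterized by: the derivative at $f$ in direction $v$ equals $\langle \nabla L(f),v\rangle_{\mathcal{H}}$ for all $v\in\mathcal{H}$. It is assumed that the loss extends to a Fréchet differentiable functional $L:\mathcal{B}\to\mathbb{R}$, and that the gradient operator extends to an operator $\nabla L:\mathcal{B}\to\mathcal{B}$ (each extension agrees with the original on $\mathcal{H}$; the same symbols are used for the extensions). $\mathrm{D}L(f;v)$ denotes the derivative of the extended $L$ at $f\in\mathcal{B}$ in direction $v\in\mathcal{B}$, and $\mathrm{D}L(f;\cdot)\in\mathcal{B}^*$. Relative error: $\mathrm{RelErr}(g,\nabla L(f)):=\lVert g-\nabla L(f)\rVert_{\mathcal{B}}/\lVert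 g\rVert_{\mathcal{B}}$, with conventions $0/0=0$ and $a/0=+\infty$ for $a>0$. The conditions referred to (with constants $K,\alpha,\beta,\mu>0$): - (Smooth) $L(f)\le L(f')+\mathrm{D}L(f';f-f')+\frac K2\lVert f-f'\rVert_{\mathcal{B}}^2$ for all $f,f'\in\mathcal{B}$. - (Descent) $\mathrm{D}L(f;\nabla L(f))\ge\alpha\lVert\nabla L(f)\rVert_{\mathcal{B}}^2$ for all $f\in\mathcal{B}$. - (Compat) $\lVert\mathrm{D}L(f;\cdot)\rVert_{\mathcal{B}^*}\le\beta\lVert\nabla L(f)\rVert_{\mathcal{B}}$ for all $f\in\mathcal{B}$. - (PL) $L(f)-L^\star\le\frac1{2\mu}\lVert\mathrm{D}L(f;\cdot)\rVert_{\mathcal{B}^*}^2$ for all $f\in\mathcal{B}$, where $L^\star=\inf_{f'\in\mathcal{H}}L(f')$. The algorithm: at step $t$, it repeatedly computes an approximation $g_t\in\mathcal{B}$ of $\nabla L(f_t)$ and an upper bound $U_t$ on $\lVert g_t-\nabla L(f_t)\rVert_{\mathcal{B}}$, refining the representation until $(1+\epsilon)U_t<\epsilon\lVert g_t\rVert_{\mathcal{B}}$; it then sets $f_{t+1}=f_t-\eta g_t$. *)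

theory Defs
  imports "HOL-Analysis.Analysis"
begin

text \<open>The dual norm on $\mathcal{B}^*$ is the library's \<^const>\<open>onorm\<close>; on bounded linear
  functionals it is the supremum over the closed unit ball:\<close>

lemma onorm_eq_SUP_unit_ball:
  fixes u :: "'b::real_normed_vector \<Rightarrow> real"
  assumes u: "bounded_linear u"
  shows "onorm u = (SUP b\<in>{b. norm b \<le> 1}. \<bar>u b\<bar>)"
proof (rule antisym)
  have le: "\<bar>u b\<bar> \<le> onorm u" if "norm b \<le> 1" for b
  proof -
    have "\<bar>u b\<bar> \<le> onorm u * norm b"
      using onorm[OF u, of b] by simp
    also have "\<dots> \<le> onorm u * 1"
      using that onorm_pos_le[OF u] by (intro mult_left_mono)
    finally show ?thesis by simp
  qed
  have bdd: "bdd_above ((\<lambda>b. \<bar>u b\<bar>) ` {b. norm b \<le> 1})"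
    using le by (auto intro!: bdd_aboveI[where M = "onorm u"])
  have ne: "{b::'b. norm b \<le> 1} \<noteq> {}"
    by (auto intro!: exI[of _ 0])
  show "(SUP b\<in>{b. norm b \<le> 1}. \<bar>u b\<bar>) \<le> onorm u"
    using le by (intro cSUP_least[OF ne]) simp
  show "onorm u \<le> (SUP b\<in>{b. norm b \<le> 1}. \<bar>u b\<bar>)"
    unfolding onorm_def
  proof (rule cSUP_least)
    fix x :: 'b
    have eq: "norm (u x) / norm x = \<bar>u (x /\<^sub>R norm x)\<bar>"
      by (simp add: linear_cmul[OF bounded_linear.linear[OF u]] abs_mult divide_inverse mult.commute)
    have "norm (x /\<^sub>R norm x) \<le> 1"
      by (cases "x = 0") auto
    then show "norm (u x) / norm x \<le> (SUP b\<in>{b. norm b \<le> 1}. \<bar>u b\<bar>)"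
      unfolding eq by (intro cSUP_upper[OF _ bdd]) simp
  qed simp
qed

definition DL :: "('b::real_normed_vector \<Rightarrow> real) \<Rightarrow> 'b \<Rightarrow> 'b \<Rightarrow> real" where
  "DL L f = frechet_derivative L (at f)"

definition smooth_cond :: "('b::real_normed_vector \<Rightarrow> real) \<Rightarrow> real \<Rightarrow> bool" where
  "smooth_cond L K \<longleftrightarrow>
     (\<forall>f f'. L f \<le> L f' + DL L f' (f - f') + K / 2 * (norm (f - f'))\<^sup>2)"

definition descent_cond ::
    "('b::real_normed_vector \<Rightarrow> real) \<Rightarrow> ('b \<Rightarrow> 'b) \<Rightarrow> real \<Rightarrow> bool" where
  "descent_cond L gradL \<alpha> \<longleftrightarrow> (\<forall>f. DL L f (gradL f) \<ge> \<alpha> * (norm (gradL f))\<^sup>2)"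

definition compat_cond ::
    "('b::real_normed_vector \<Rightarrow> real) \<Rightarrow> ('b \<Rightarrow> 'b) \<Rightarrow> real \<Rightarrow> bool" where
  "compat_cond L gradL \<beta> \<longleftrightarrow> (\<forall>f. onorm (DL L f) \<le> \<beta> * norm (gradL f))"

definition PL_cond :: "('b::real_normed_vector \<Rightarrow> real) \<Rightarrow> real \<Rightarrow> real \<Rightarrow> bool" where
  "PL_cond L Lstar \<mu> \<longleftrightarrow> (\<forall>f. L f - Lstar \<le> 1 / (2 * \<mu>) * (onorm (DL L f))\<^sup>2)"

text \<open>Division is taken in \<^typ>\<open>ereal\<close>, which realises the conventions $0/0 = 0$ and
  $a/0 = +\infty$ for $a > 0$ (see the lemmas below).\<close>

definition rel_err :: "'b::real_normed_vector \<Rightarrow> 'b \<Rightarrow> ereal" where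
  "rel_err g G = ereal (norm (g - G)) / ereal (norm g)"

lemma rel_err_nonzero: "g \<noteq> 0 \<Longrightarrow> rel_err g G = ereal (norm (g - G) / norm g)"
  by (simp add: rel_err_def)

lemma rel_err_zero_zero: "rel_err 0 0 = 0"
  by (simp add: rel_err_def)

lemma rel_err_zero_nonzero: "G \<noteq> 0 \<Longrightarrow> rel_err 0 G = \<infinity>"
  by (simp add: rel_err_def divide_ereal_def)

text \<open>Only the entries $f_0,\dots,f_T$, $g_0,\dots,g_{T-1}$ and $U_0,\dots,U_{T-1}$ of the
  sequences are constrained. The two inequalities are the guarantee on \<open>U t\<close> and the
  exit condition of the refinement loop at step \<open>t\<close>.\<close>

definition adaptive_fgd ::
    "('b::real_normed_vector \<Rightarrow> 'b) \<Rightarrow> real \<Rightarrow> real \<Rightarrow> nat \<Rightarrow>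
     (nat \<Rightarrow> 'b) \<Rightarrow> (nat \<Rightarrow> 'b) \<Rightarrow> (nat \<Rightarrow> real) \<Rightarrow> bool" where
  "adaptive_fgd gradL \<epsilon> \<eta> T f g U \<longleftrightarrow>
     (\<forall>t<T. norm (g t - gradL (f t)) \<le> U t \<and>
            (1 + \<epsilon>) * U t < \<epsilon> * norm (g t) \<and>
            f (Suc t) = f t - \<eta> *\<^sub>R g t)"

end

theory Submission
  imports Defs
begin

text \<open>The exit condition of the refinement loop makes the error of \<open>g t\<close> at most
  \<open>\<epsilon> / (1 + \<epsilon>)\<close> times its own norm, hence at most \<open>\<epsilon>\<close> times the norm of the true gradient.
  Smoothness, descent and compatibility then show that a step decreases \<open>L\<close> by at least
  \<open>\<eta> * r\<close> times the squared gradient norm. Telescoping gives the stationarity bound, and the PL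
  inequality turns the decrease into a linear contraction of \<open>L - Lstar\<close>.\<close>

text \<open>By the triangle inequality \<open>norm g\<close> is at most
  \<open>norm (g - G) + norm G\<close>; the resulting \<open>\<epsilon> * norm (g - G)\<close>
  cancels against the factor \<open>1 + \<epsilon>\<close>. This passes from an error relative to
  the computed \<open>g\<close> to one relative to the true \<open>G\<close>.\<close>

lemma norm_diff_le_norm_of_relative_error:
  fixes g G :: "'b::real_normed_vector"
  assumes "(1 + \<epsilon>) * norm (g - G) \<le> \<epsilon> * norm g" and "0 \<le> \<epsilon>"
  shows "norm (g - G) \<le> \<epsilon> * norm G"
proof -
  have "\<epsilon> * norm g \<le> \<epsilon> * (norm (g - G) + norm G)"
    using norm_triangle_ineq[of "g - G" G] assms(2) by (intro mult_left_mono) simp_all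
  then show ?thesis
    using assms(1) by (simp add: algebra_simps)
qed

text \<open>Split \<open>g\<close> into \<open>gradL x\<close> plus an error: descent bounds the
  derivative along the first part from below, compatibility bounds it along the second, and
  smoothness pays for the step length. Here \<open>\<epsilon>\<close> measures the error against the
  true gradient.\<close>

lemma inexact_gradient_step_decrease:
  fixes L :: "'b::real_normed_vector \<Rightarrow> real"
  assumes diff: "L differentiable (at x)"
    and smooth: "smooth_cond L K" and descent: "descent_cond L gradL \<alpha>"
    and compat: "compat_cond L gradL \<beta>"
    and "0 \<le> K" "0 \<le> \<eta>" "0 \<le> \<epsilon>" "\<epsilon> \<le> 1"
    and err: "norm (g - gradL x) \<le> \<epsilon> * norm (gradL x)"
  shows "L (x - \<eta> *\<^sub>R g)
    \<le> L x - \<eta> * (\<alpha> - K * \<eta> / 2 - (\<beta> + 3 / 2 * K * \<eta>) * \<epsilon>) * (norm (gradL x))\<^sup>2"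
proof -
  define n where "n = norm (gradL x)"
  have bl: "bounded_linear (DL L x)"
    using diff unfolding DL_def frechet_derivative_works
    by (rule has_derivative_bounded_linear)
  have dual: "onorm (DL L x) \<le> \<beta> * n"
    using compat unfolding compat_cond_def n_def by blast
  have "\<bar>DL L x (g - gradL x)\<bar> \<le> onorm (DL L x) * norm (g - gradL x)"
    using onorm[OF bl, of "g - gradL x"] by simp
  \<comment> \<open>The product estimate needs \<open>\<beta> * n\<close> nonnegative, which holds
    because it dominates a dual norm.\<close>
  also have "\<dots> \<le> (\<beta> * n) * (\<epsilon> * n)"
    using err order_trans[OF onorm_pos_le[OF bl] dual]
    by (intro mult_mono dual) (simp_all add: n_def)
  finally have "DL L x (g - gradL x) \<ge> - (\<beta> * \<epsilon> * n\<^sup>2)"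
    by (simp add: power2_eq_square mult_ac)
  moreover have "DL L x (gradL x) \<ge> \<alpha> * n\<^sup>2"
    using descent unfolding descent_cond_def n_def by blast
  ultimately have "(\<alpha> - \<beta> * \<epsilon>) * n\<^sup>2 \<le> DL L x g"
    by (simp add: linear_diff[OF bounded_linear.linear[OF bl]] algebra_simps)
  then have lin: "\<eta> * ((\<alpha> - \<beta> * \<epsilon>) * n\<^sup>2) \<le> \<eta> * DL L x g"
    using \<open>0 \<le> \<eta>\<close> by (rule mult_left_mono)
  have "norm g \<le> (1 + \<epsilon>) * n"
    using norm_triangle_ineq[of "g - gradL x" "gradL x"] err
    by (simp add: n_def algebra_simps)
  then have "(norm g)\<^sup>2 \<le> (1 + \<epsilon>)\<^sup>2 * n\<^sup>2"
    by (metis norm_ge_zero power_mono power_mult_distrib)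
  \<comment> \<open>Uses \<open>\<epsilon> * \<epsilon> \<le> \<epsilon>\<close>; this linearization
    is the source of the coefficient 3/2 in the rate.\<close>
  also have "(1 + \<epsilon>)\<^sup>2 \<le> 1 + 3 * \<epsilon>"
    using mult_left_mono[OF \<open>\<epsilon> \<le> 1\<close> \<open>0 \<le> \<epsilon>\<close>] by (simp add: power2_eq_square algebra_simps)
  finally have "(norm g)\<^sup>2 \<le> (1 + 3 * \<epsilon>) * n\<^sup>2"
    by (simp add: mult_right_mono)
  then have quad: "K / 2 * \<eta>\<^sup>2 * (norm g)\<^sup>2 \<le> K / 2 * \<eta>\<^sup>2 * ((1 + 3 * \<epsilon>) * n\<^sup>2)"
    using \<open>0 \<le> K\<close> by (intro mult_left_mono) simp_all
  have "L (x - \<eta> *\<^sub>R g) \<le> L x + DL L x (- (\<eta> *\<^sub>R g)) + K / 2 * (norm (\<eta> *\<^sub>R g))\<^sup>2"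
    using smooth[unfolded smooth_cond_def, rule_format, of "x - \<eta> *\<^sub>R g" x] by simp
  also have "\<dots> = L x - \<eta> * DL L x g + K / 2 * \<eta>\<^sup>2 * (norm g)\<^sup>2"
    by (simp add: linear_neg[OF bounded_linear.linear[OF bl]]
        linear_cmul[OF bounded_linear.linear[OF bl]] power_mult_distrib)
  also have "\<dots> \<le> L x - \<eta> * ((\<alpha> - \<beta> * \<epsilon>) * n\<^sup>2) + K / 2 * \<eta>\<^sup>2 * ((1 + 3 * \<epsilon>) * n\<^sup>2)"
    using lin quad by linarith
  also have "\<dots> = L x - \<eta> * (\<alpha> - K * \<eta> / 2 - (\<beta> + 3 / 2 * K * \<eta>) * \<epsilon>) * n\<^sup>2"
    by (simp add: field_simps power2_eq_square)
  finally show ?thesis by (simp add: n_def)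
qed

text \<open>Each decrease is at least \<open>c\<close> times the minimum of \<open>b\<close>, and
  the \<open>T\<close> decreases sum to \<open>a 0 - a T\<close>.\<close>

lemma Min_le_of_telescoping_decrease:
  fixes a b :: "nat \<Rightarrow> real"
  assumes step: "\<And>t. t < T \<Longrightarrow> a (Suc t) \<le> a t - c * b t"
    and "lower \<le> a T" and "0 < c" and "0 < T"
  shows "Min (b ` {0..<T}) \<le> (a 0 - lower) / (real T * c)"
proof -
  let ?m = "Min (b ` {0..<T})"
  have "real T * (c * ?m) = (\<Sum>t<T. c * ?m)"
    by simp
  also have "\<dots> \<le> (\<Sum>t<T. a t - a (Suc t))"
  proof (rule sum_mono)
    fix t assume "t \<in> {..<T}"
    then have "c * ?m \<le> c * b t"
      using \<open>0 < c\<close> by (intro mult_left_mono Min_le) auto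
    with step[of t] \<open>t \<in> {..<T}\<close> show "c * ?m \<le> a t - a (Suc t)"
      by simp
  qed
  also have "\<dots> = a 0 - a T"
    by (rule sum_lessThan_telescope')
  finally show ?thesis
    using assms(2-4) by (simp add: field_simps)
qed

text \<open>The rate \<open>q\<close> may be negative, but nonnegativity of \<open>a\<close> then forces \<open>a 0 = \<dots> = a T = 0\<close>.\<close>

lemma geometric_decay:
  fixes a :: "nat \<Rightarrow> real"
  assumes nonneg: "\<And>t. 0 \<le> a t" and step: "\<And>t. t < T \<Longrightarrow> a (Suc t) \<le> q * a t"
  shows "a T \<le> q ^ T * a 0"
proof (cases "0 \<le> q")
  case True
  have "t \<le> T \<Longrightarrow> a t \<le> q ^ t * a 0" for t
  proof (induction t)
    case (Suc t)
    then have "a (Suc t) \<le> q * a t"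
      using step by simp
    also have "\<dots> \<le> q * (q ^ t * a 0)"
      using Suc True by (intro mult_left_mono) simp_all
    finally show ?case
      by (simp add: mult_ac)
  qed simp
  then show ?thesis by simp
next
  case False
  have zero: "a t = 0" if "t < T" for t
    using nonneg[of t] order_trans[OF nonneg step[OF that]] False
    by (simp add: zero_le_mult_iff)
  show ?thesis
  \<comment> \<open>Vanishing is known only below \<open>T\<close>; the last step then gives
    \<open>a T \<le> q * 0\<close>. For \<open>T = 0\<close> both sides are
    \<open>a 0\<close>.\<close>
  proof (cases T)
    case (Suc n)
    with step[of n] zero[of n] zero[of 0] show ?thesis by simp
  qed simp
qed

text \<open>Multiplied by \<open>1 - e\<close>, the rate becomes \<open>\<alpha> - (\<alpha> +
  \<beta>) * e - K * \<eta> / 2 * (1 + 2 * e)\<close>, whose positivity is exactly the bound on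
  \<open>\<eta>\<close>.\<close>

lemma decrease_rate_pos:
  fixes \<alpha> \<beta> K \<eta> e :: real
  assumes "0 < K" and "0 \<le> e" and "e < 1"
    and "\<eta> < 2 * (\<alpha> - (\<alpha> + \<beta>) * e) / (K * (2 * e + 1))"
  shows "0 < \<alpha> - K * \<eta> / 2 - (\<beta> + 3 / 2 * K * \<eta>) * (e / (1 - e))"
proof -
  have "0 < K * (2 * e + 1)"
    using assms by simp
  then have "\<eta> * (K * (2 * e + 1)) < 2 * (\<alpha> - (\<alpha> + \<beta>) * e)"
    using assms(4) by (simp add: pos_less_divide_eq)
  then have "0 < (\<alpha> - K * \<eta> / 2) * (1 - e) - (\<beta> + 3 / 2 * K * \<eta>) * e"
    by (simp add: field_simps)
  also have "\<dots> = (1 - e) * (\<alpha> - K * \<eta> / 2 - (\<beta> + 3 / 2 * K * \<eta>) * (e / (1 - e)))"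
    using assms(3) by (simp add: right_diff_distrib mult.commute)
  finally show ?thesis
    using assms(3) by (simp add: zero_less_mult_iff)
qed

text \<open>PL followed by compatibility bounds the squared gradient norm below by
  \<open>2 * \<mu> / \<beta>^2\<close> times the gap at \<open>x\<close>; the assumed decrease is
  thus proportional to that gap.\<close>

lemma PL_contraction:
  fixes \<beta> \<mu> :: real
  assumes PL: "PL_cond L Lstar \<mu>" and compat: "compat_cond L gradL \<beta>"
    and diff: "L differentiable (at x)"
    and decrease: "L y \<le> L x - \<eta> * r * (norm (gradL x))\<^sup>2"
    and pos: "0 < \<mu>" "0 < \<beta>" "0 \<le> \<eta>" "0 \<le> r"
  shows "L y - Lstar \<le> (1 - 2 * \<eta> * inverse (\<beta>\<^sup>2) * \<mu> * r) * (L x - Lstar)"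
proof -
  have bl: "bounded_linear (DL L x)"
    using diff unfolding DL_def frechet_derivative_works
    by (rule has_derivative_bounded_linear)
  have "L x - Lstar \<le> 1 / (2 * \<mu>) * (onorm (DL L x))\<^sup>2"
    using PL unfolding PL_cond_def by blast
  also have "\<dots> \<le> 1 / (2 * \<mu>) * (\<beta> * norm (gradL x))\<^sup>2"
    using compat onorm_pos_le[OF bl] pos unfolding compat_cond_def
    by (intro mult_left_mono power_mono) simp_all
  finally have "2 * \<mu> * inverse (\<beta>\<^sup>2) * (L x - Lstar) \<le> (norm (gradL x))\<^sup>2"
    using pos by (simp add: field_simps)
  then have "\<eta> * r * (2 * \<mu> * inverse (\<beta>\<^sup>2) * (L x - Lstar)) \<le> \<eta> * r * (norm (gradL x))\<^sup>2"
    using pos by (intro mult_left_mono) simp_all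
  then show ?thesis
    using decrease by (simp add: algebra_simps)
qed

text \<open>The inclusion of the Hilbert space is modelled by the injective linear map
  \<open>\<iota>\<close>, along which \<open>L\<close> and \<open>gradL\<close> extend
  \<open>loss\<close> and \<open>grad_loss\<close>. The third claim is nested in the second because
  it inherits its hypotheses and \<open>r\<close>.\<close>

theorem theorem3p10:
  fixes \<iota> :: "'h::{real_inner,complete_space} \<Rightarrow> 'b::banach"
    and loss :: "'h \<Rightarrow> real" and grad_loss :: "'h \<Rightarrow> 'h"
    and L :: "'b \<Rightarrow> real" and gradL :: "'b \<Rightarrow> 'b"
    and \<epsilon> \<eta> :: real and T :: nat
    and f g :: "nat \<Rightarrow> 'b" and U :: "nat \<Rightarrow> real"
  assumes "linear \<iota>" and "inj \<iota>"
    and "\<And>h. GDERIV loss h :> grad_loss h"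
    and "\<And>h. L (\<iota> h) = loss h"
    and "\<And>x. L differentiable (at x)"
    and "\<And>h. gradL (\<iota> h) = \<iota> (grad_loss h)"
    and "0 < \<epsilon>" and "\<epsilon> < 1" and "\<eta> > 0" and "T \<ge> 1"
    and "adaptive_fgd gradL \<epsilon> \<eta> T f g U"
  shows "(\<forall>t<T. rel_err (g t) (gradL (f t)) \<le> ereal (\<epsilon> / (1 + \<epsilon>)))
    \<and> \<epsilon> / (1 + \<epsilon>) < 1 / 2
    \<and> (\<forall>K \<alpha> \<beta> Lstar \<epsilon>bar r :: real.
         \<epsilon>bar = \<epsilon> / (1 + \<epsilon>) \<longrightarrow>
         r = \<alpha> - K * \<eta> / 2 - (\<beta> + 3 / 2 * K * \<eta>) * (\<epsilon>bar / (1 - \<epsilon>bar)) \<longrightarrow>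
         K > 0 \<longrightarrow> \<alpha> > 0 \<longrightarrow> \<beta> > 0 \<longrightarrow>
         smooth_cond L K \<longrightarrow> descent_cond L gradL \<alpha> \<longrightarrow> compat_cond L gradL \<beta> \<longrightarrow>
         (\<forall>x. L x \<ge> Lstar) \<longrightarrow>
         \<epsilon>bar < min (1 / 2) (\<alpha> / (\<alpha> + \<beta>)) \<longrightarrow>
         \<eta> < 2 * (\<alpha> - (\<alpha> + \<beta>) * \<epsilon>bar) / (K * (2 * \<epsilon>bar + 1)) \<longrightarrow>
           r > 0
           \<and> Min ((\<lambda>t. (norm (gradL (f t)))\<^sup>2) ` {0..<T}) \<le> (L (f 0) - Lstar) / (real T * \<eta> * r)
           \<and> (\<forall>\<mu>>0. Lstar = (INF h. L (\<iota> h)) \<longrightarrow> PL_cond L Lstar \<mu> \<longrightarrow>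
                L (f T) - Lstar \<le> (1 - 2 * \<eta> * inverse (\<beta>\<^sup>2) * \<mu> * r) ^ T * (L (f 0) - Lstar)))"
proof -
  have exit: "norm (g t - gradL (f t)) \<le> U t" "(1 + \<epsilon>) * U t < \<epsilon> * norm (g t)"
    and step: "f (Suc t) = f t - \<eta> *\<^sub>R g t" if "t < T" for t
    using assms(11) that unfolding adaptive_fgd_def by auto
  have err: "(1 + \<epsilon>) * norm (g t - gradL (f t)) \<le> \<epsilon> * norm (g t)" if "t < T" for t
    using mult_left_mono[OF exit(1)[OF that], of "1 + \<epsilon>"] exit(2)[OF that] \<open>0 < \<epsilon>\<close> by linarith
  \<comment> \<open>The quotient of \<open>\<epsilon>bar\<close> by \<open>1 - \<epsilon>bar\<close>
    in \<open>r\<close> is \<open>\<epsilon>\<close> itself, the error level relative to the true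
    gradient.\<close>
  have ratio: "\<epsilon> / (1 + \<epsilon>) / (1 - \<epsilon> / (1 + \<epsilon>)) = \<epsilon>"
    using \<open>0 < \<epsilon>\<close> by (simp add: field_simps)
  have ebar: "0 \<le> \<epsilon> / (1 + \<epsilon>)" "\<epsilon> / (1 + \<epsilon>) < 1 / 2"
    using \<open>0 < \<epsilon>\<close> \<open>\<epsilon> < 1\<close> by (simp_all add: field_simps)
  have "rel_err (g t) (gradL (f t)) \<le> ereal (\<epsilon> / (1 + \<epsilon>))" if "t < T" for t
  proof -
    have "0 \<le> U t"
      using exit(1)[OF that] norm_ge_zero order_trans by blast
    then have "0 \<le> (1 + \<epsilon>) * U t"
      using \<open>0 < \<epsilon>\<close> by simp
    \<comment> \<open>The strict exit condition with a nonnegative left side excludes a zero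
      denominator, so the error is an ordinary real quotient.\<close>
    then have "g t \<noteq> 0"
      using exit(2)[OF that] by auto
    then show ?thesis
      using err[OF that] \<open>0 < \<epsilon>\<close> by (simp add: rel_err_nonzero field_simps)
  qed
  moreover have
    "r > 0
      \<and> Min ((\<lambda>t. (norm (gradL (f t)))\<^sup>2) ` {0..<T}) \<le> (L (f 0) - Lstar) / (real T * \<eta> * r)
      \<and> (\<forall>\<mu>>0. Lstar = (INF h. L (\<iota> h)) \<longrightarrow> PL_cond L Lstar \<mu> \<longrightarrow>
          L (f T) - Lstar \<le> (1 - 2 * \<eta> * inverse (\<beta>\<^sup>2) * \<mu> * r) ^ T * (L (f 0) - Lstar))"
    if e: "\<epsilon>bar = \<epsilon> / (1 + \<epsilon>)"
      and r: "r = \<alpha> - K * \<eta> / 2 - (\<beta> + 3 / 2 * K * \<eta>) * (\<epsilon>bar / (1 - \<epsilon>bar))"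
      and pos: "K > 0" "\<beta> > 0"
      and conds: "smooth_cond L K" "descent_cond L gradL \<alpha>" "compat_cond L gradL \<beta>"
      and lower: "\<forall>x. L x \<ge> Lstar"
      and eta: "\<eta> < 2 * (\<alpha> - (\<alpha> + \<beta>) * \<epsilon>bar) / (K * (2 * \<epsilon>bar + 1))"
    for K \<alpha> \<beta> Lstar \<epsilon>bar r :: real
  proof -
    have "0 \<le> \<epsilon>bar" "\<epsilon>bar < 1"
      using ebar unfolding e by linarith+
    then have "r > 0"
      unfolding r using pos(1) eta by (intro decrease_rate_pos)
    have decrease: "L (f (Suc t)) \<le> L (f t) - \<eta> * r * (norm (gradL (f t)))\<^sup>2" if "t < T" for t
      unfolding step[OF that] r e ratio
      using norm_diff_le_norm_of_relative_error[OF err[OF that]] conds pos assms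
      by (intro inexact_gradient_step_decrease) simp_all
    have "Min ((\<lambda>t. (norm (gradL (f t)))\<^sup>2) ` {0..<T}) \<le> (L (f 0) - Lstar) / (real T * \<eta> * r)"
      unfolding mult.assoc[of "real T"]
      using decrease lower \<open>r > 0\<close> \<open>\<eta> > 0\<close> \<open>T \<ge> 1\<close>
      by (intro Min_le_of_telescoping_decrease[where a = "\<lambda>t. L (f t)"]) simp_all
    moreover have
      "L (f T) - Lstar \<le> (1 - 2 * \<eta> * inverse (\<beta>\<^sup>2) * \<mu> * r) ^ T * (L (f 0) - Lstar)"
      if "\<mu> > 0" "PL_cond L Lstar \<mu>" for \<mu>
      \<comment> \<open>As \<open>Lstar\<close> bounds \<open>L\<close> everywhere, the gap is
        nonnegative at every index, which covers a negative contraction factor too.\<close>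
      using lower PL_contraction[OF that(2) conds(3) assms(5) decrease that(1) pos(2)]
        \<open>r > 0\<close> \<open>\<eta> > 0\<close>
      by (intro geometric_decay[where a = "\<lambda>t. L (f t) - Lstar"]) simp_all
    ultimately show ?thesis
      using \<open>r > 0\<close> by blast
  qed
  ultimately show ?thesis
    using ebar(2) by blast
qed

end
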